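(* Let $1<p<\infty$ and $0<\gamma<1$ be such that $\gamma p<1$. There is a constant $C>0$ such that $\mathcal{C}_{\gamma,p}(B(x,r))\le C\,\mu(B(x,r))^{1-\gamma p}$ for every ball $B(x,r)$ in $X$, and, with this same constant $C$, $$\mathcal{C}_{\gamma,p}(E)\le C\,\widetilde{\mathcal{H}}^{\gamma,p}_\infty(E)\qquad\text{for each } E\subset X.$$
   Context: Setting: $X=(X,d,\mu)$ is a locally compact metric space equipped with a Borel regular outer measure $\mu$ that is doubling, i.e. there is a constant $c_d\ge 1$ with $\mu(B(x,2r))\le c_d\,\mu(B(x,r))$ for every ball $B(x,r)=\{y\in X: d(y,x)<r\}$. Every open ball has positive and finite measure. Spheres have measure zero, $\mu(\{y\in X: d(x,y)=r\})=0$ for all $x\in X$, $r>0$, and points have measure zero, $\mu(\{x\})=0$ for all $x\in X$. For $0<\gamma<1$, the Riesz potential of order $\gamma$ of a measurable function $f$ is $$I_\gamma f(x)=\int_X \frac{f(y)}{\mu(B(x,d(x,y)))^{1-\gamma}}\,d\mu(y)$$ (the single point $y=x$ may be omitted from the domain of integration, since it is $\mu$-null). $L^p_+(X)$ denotes the set of non-negative functions in $L^p(X)=L^p(X,\mu)$. For $1<p<\infty$ and any $E\subset X$, the Riesz $(\gamma,p)$-capacity is $\mathcal{C}_{\gamma,p}(E)=\inf_{f\in\mathcal{A}(E)}\|f\|_{L^p(X)}^p$, where $\mathcal{A}(E)=\{f\in L^p_+(X): I_\gamma f\ge 1\text{ on }E\}$ and $\mathcal{C}_{\gamma,p}(E)=\infty$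 if $\mathcal{A}(E)=\emptyset$. For $\gamma p<1$ and $0<r\le\infty$, the (modified) Hausdorff content of $E\subset X$ is $$\widetilde{\mathcal{H}}^{\gamma,p}_r(E)=\inf\Big\{\sum_{i=1}^\infty\mu(B(x_i,r_i))^{1-\gamma p}:E\subset\bigcup_{i=1}^\infty B(x_i,r_i),\ x_i\in E,\ r_i\le r\Big\},$$ where the balls have finite positive radii, finite covers are also allowed, and the content of $\emptyset$ is $0$. *)

theory Defs
  imports "HOL-Analysis.Analysis"
begin

text \<open>
  As in the metric-measure literature, \<open>\<mu>\<close> is an outer measure defined on all subsets of the space.
  A set is measurable when it satisfies the Caratheodory criterion, so
  measurable functions and integrals refer to the following measure.
\<close>

definition caratheodory_measure :: "('a set \<Rightarrow> ennreal) \<Rightarrow> 'a measure" where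
  "caratheodory_measure \<mu> = measure_of UNIV (lambda_system UNIV (Pow UNIV) \<mu>) \<mu>"

lemma space_caratheodory_measure [simp]: "space (caratheodory_measure \<mu>) = UNIV"
  by (simp add: caratheodory_measure_def space_measure_of_conv)

lemma measure_space_caratheodory:
  assumes "outer_measure_space (Pow UNIV) \<mu>"
  shows "measure_space UNIV (lambda_system UNIV (Pow UNIV) \<mu>) \<mu>"
proof -
  interpret sigma_algebra UNIV "Pow UNIV :: 'a set set"
    by (rule sigma_algebra_Pow)
  show ?thesis
    using caratheodory_lemma[OF assms] .
qed

lemma sets_caratheodory_measure:
  assumes "outer_measure_space (Pow UNIV) \<mu>"
  shows "sets (caratheodory_measure \<mu>) = lambda_system UNIV (Pow UNIV) \<mu>"
  using measure_space_caratheodory[OF assms]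
  unfolding caratheodory_measure_def measure_space_def
  by (metis sigma_algebra.sets_measure_of_eq)

lemma emeasure_caratheodory_measure:
  assumes "outer_measure_space (Pow UNIV) \<mu>" and "A \<in> lambda_system UNIV (Pow UNIV) \<mu>"
  shows "emeasure (caratheodory_measure \<mu>) A = \<mu> A"
  using measure_space_caratheodory[OF assms(1)] assms(2)
  unfolding caratheodory_measure_def measure_space_def
  by (metis emeasure_measure_of_sigma)

locale doubling_metric_measure_space =
  fixes \<mu> :: "'a::metric_space set \<Rightarrow> ennreal"
  assumes locally_compact: "locally_compact_space (euclidean :: 'a topology)"
    and outer_measure: "outer_measure_space (Pow UNIV) \<mu>"
    and borel_measurable_sets: "sets borel \<subseteq> lambda_system UNIV (Pow UNIV) \<mu>"
    and borel_regular: "\<And>A. \<exists>B\<in>sets borel. A \<subseteq> B \<and> \<mu> B = \<mu> A"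
    and doubling: "\<exists>c::real. c \<ge> 1 \<and> (\<forall>x r. r > 0 \<longrightarrow> \<mu> (ball x (2 * r)) \<le> ennreal c * \<mu> (ball x r))"
    and ball_pos: "\<And>x r. r > 0 \<Longrightarrow> 0 < \<mu> (ball x r)"
    and ball_finite: "\<And>x r. r > 0 \<Longrightarrow> \<mu> (ball x r) < \<infinity>"
    and sphere_null: "\<And>x r. r > 0 \<Longrightarrow> \<mu> (sphere x r) = 0"
    and point_null: "\<And>x. \<mu> {x} = 0"

text \<open>
  Real powers \<open>\<mu>(B(x,r))\<^sup>s\<close>. Passing through \<^const>\<open>enn2real\<close> loses nothing, because
  balls have finite measure.
\<close>

definition ball_powr :: "('a::metric_space set \<Rightarrow> ennreal) \<Rightarrow> 'a \<Rightarrow> real \<Rightarrow> real \<Rightarrow> real" where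
  "ball_powr \<mu> x r s = enn2real (\<mu> (ball x r)) powr s"

text \<open>
  The potential is only used for non-negative \<open>f\<close>, where it takes values in \<open>[0,\<infinity>]\<close>. The
  null set \<open>{x}\<close>, on which the kernel is a division by zero, is left out.
\<close>

definition riesz_potential ::
    "('a::metric_space set \<Rightarrow> ennreal) \<Rightarrow> real \<Rightarrow> ('a \<Rightarrow> real) \<Rightarrow> 'a \<Rightarrow> ennreal" where
  "riesz_potential \<mu> \<gamma> f x =
     (\<integral>\<^sup>+ y \<in> - {x}. ennreal (f y / ball_powr \<mu> x (dist x y) (1 - \<gamma>)) \<partial>caratheodory_measure \<mu>)"

definition Lp_space :: "('a set \<Rightarrow> ennreal) \<Rightarrow> real \<Rightarrow> ('a \<Rightarrow> real) set" where
  "Lp_space \<mu> p = {f \<in> borel_measurable (caratheodory_measure \<mu>).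
     integrable (caratheodory_measure \<mu>) (\<lambda>x. \<bar>f x\<bar> powr p)}"

definition Lp_norm :: "('a set \<Rightarrow> ennreal) \<Rightarrow> real \<Rightarrow> ('a \<Rightarrow> real) \<Rightarrow> real" where
  "Lp_norm \<mu> p f = (\<integral>x. \<bar>f x\<bar> powr p \<partial>caratheodory_measure \<mu>) powr (1 / p)"

definition Lp_nonneg :: "('a set \<Rightarrow> ennreal) \<Rightarrow> real \<Rightarrow> ('a \<Rightarrow> real) set" where
  "Lp_nonneg \<mu> p = {f \<in> Lp_space \<mu> p. \<forall>x. 0 \<le> f x}"

definition riesz_admissible ::
    "('a::metric_space set \<Rightarrow> ennreal) \<Rightarrow> real \<Rightarrow> real \<Rightarrow> 'a set \<Rightarrow> ('a \<Rightarrow> real) set" where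
  "riesz_admissible \<mu> \<gamma> p E = {f \<in> Lp_nonneg \<mu> p. \<forall>x\<in>E. 1 \<le> riesz_potential \<mu> \<gamma> f x}"

text \<open>The infimum is taken in \<^typ>\<open>ennreal\<close>, so it is \<open>\<infinity>\<close> when no function is admissible.\<close>

definition riesz_capacity ::
    "('a::metric_space set \<Rightarrow> ennreal) \<Rightarrow> real \<Rightarrow> real \<Rightarrow> 'a set \<Rightarrow> ennreal" where
  "riesz_capacity \<mu> \<gamma> p E = (INF f \<in> riesz_admissible \<mu> \<gamma> p E. ennreal (Lp_norm \<mu> p f powr p))"

text \<open>
  Covers are indexed by an arbitrary \<open>I \<subseteq> \<nat>\<close>, which gives the countably infinite, the finite and
  (for the empty set) the empty covers; centres lie in \<open>E\<close>.
\<close>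

definition modified_hausdorff_content ::
    "('a::metric_space set \<Rightarrow> ennreal) \<Rightarrow> real \<Rightarrow> real \<Rightarrow> ereal \<Rightarrow> 'a set \<Rightarrow> ennreal" where
  "modified_hausdorff_content \<mu> \<gamma> p R E =
     Inf {(\<Sum>i. if i \<in> I then ennreal (ball_powr \<mu> (x i) (r i) (1 - \<gamma> * p)) else 0)
          | (I :: nat set) (x :: nat \<Rightarrow> 'a) (r :: nat \<Rightarrow> real).
            E \<subseteq> (\<Union>i\<in>I. ball (x i) (r i)) \<and>
            (\<forall>i\<in>I. x i \<in> E \<and> 0 < r i \<and> ereal (r i) \<le> R)}"

end

theory Submission
  imports Defs
begin

text \<open>
  Why the theorem holds. Two points \<open>z, y\<close> of a ball \<open>B = B(x,r)\<close> satisfy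
  \<open>B(z,d(z,y)) \<subseteq> B(x,4r)\<close>, so by doubling the kernel \<open>\<mu>(B(z,d(z,y)))\<^sup>\<gamma>\<^sup>-\<^sup>1\<close> is at least
  \<open>(c\<^sup>2\<mu>(B))\<^sup>\<gamma>\<^sup>-\<^sup>1\<close> throughout \<open>B\<close>. A multiple of the indicator function of \<open>B\<close>, of height comparable
  to \<open>\<mu>(B)\<^sup>-\<^sup>\<gamma>\<close>, therefore has potential at least 1 on \<open>B\<close>, and the \<open>p\<close>-th power of its norm is a
  constant times \<open>\<mu>(B)\<^sup>1\<^sup>-\<^sup>\<gamma>\<^sup>p\<close> (\<open>admissible_for_ball\<close>).

  The bound by the content follows because the capacity is countably subadditive. This is used in
  the form of \<open>riesz_capacity_le_suminf\<close>: functions \<open>f\<^sub>i\<close> admissible for the members of a cover combine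
  to \<open>(\<Sum>\<^sub>i f\<^sub>i\<^sup>p)\<^sup>1\<^sup>/\<^sup>p\<close>, which dominates every \<open>f\<^sub>i\<close> almost everywhere and the \<open>p\<close>-th power of whose norm is
  the sum of the \<open>p\<close>-th powers of the norms of the \<open>f\<^sub>i\<close>. Applied to the test functions of the balls, with no loss in the
  constant, it gives the second inequality with the same \<open>C\<close>.
\<close>

lemma ball_powr_nonneg: "0 \<le> ball_powr \<mu> x r s"
  by (simp add: ball_powr_def)

lemma Lp_norm_powr_eq_nn_integral:
  assumes "f \<in> Lp_nonneg \<mu> p" "0 < p"
  shows "ennreal (Lp_norm \<mu> p f powr p) = (\<integral>\<^sup>+x. ennreal (f x powr p) \<partial>caratheodory_measure \<mu>)"
proof -
  have int: "integrable (caratheodory_measure \<mu>) (\<lambda>x. f x powr p)"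
    and nonneg: "\<And>x. 0 \<le> f x"
    using assms(1) by (auto simp: Lp_nonneg_def Lp_space_def)
  have "Lp_norm \<mu> p f powr p = (\<integral>x. f x powr p \<partial>caratheodory_measure \<mu>)"
    using assms(2) nonneg by (simp add: Lp_norm_def powr_powr)
  then show ?thesis
    using nn_integral_eq_integral[OF int] by simp
qed

text \<open>The bound is an almost everywhere one because the function built in
  \<open>riesz_capacity_le_suminf\<close> dominates the given ones only off the null set where their
  \<open>\<ell>\<^sup>p\<close>-sum is infinite.\<close>

lemma riesz_potential_mono_AE:
  assumes "AE y in caratheodory_measure \<mu>. f y \<le> g y"
  shows "riesz_potential \<mu> \<gamma> f x \<le> riesz_potential \<mu> \<gamma> g x"
  unfolding riesz_potential_def
proof (rule nn_integral_mono_AE)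
  show "AE y in caratheodory_measure \<mu>.
      ennreal (f y / ball_powr \<mu> x (dist x y) (1 - \<gamma>)) * indicator (- {x}) y
      \<le> ennreal (g y / ball_powr \<mu> x (dist x y) (1 - \<gamma>)) * indicator (- {x}) y"
    using assms
    by eventually_elim
      (intro mult_right_mono ennreal_leI divide_right_mono ball_powr_nonneg, auto)
qed

text \<open>
  Working with chosen admissible functions rather than with the capacities of the \<open>A i\<close>
  avoids picking near-minimizers: the \<open>\<ell>\<^sup>p\<close>-sum of the \<open>f i\<close> is admissible for the union.
\<close>

lemma riesz_capacity_le_suminf:
  fixes A :: "nat \<Rightarrow> 'a::metric_space set"
  assumes p: "0 < p"
    and adm: "\<And>i. f i \<in> riesz_admissible \<mu> \<gamma> p (A i)"
    and cover: "E \<subseteq> (\<Union>i. A i)"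
  shows "riesz_capacity \<mu> \<gamma> p E \<le> (\<Sum>i. ennreal (Lp_norm \<mu> p (f i) powr p))"
proof (cases "(\<Sum>i. ennreal (Lp_norm \<mu> p (f i) powr p)) = \<infinity>")
  case True
  then show ?thesis by simp
next
  case False
  let ?M = "caratheodory_measure \<mu>"
  have f_Lp: "f i \<in> Lp_nonneg \<mu> p" and f_ge_1: "\<And>x. x \<in> A i \<Longrightarrow> 1 \<le> riesz_potential \<mu> \<gamma> (f i) x" for i
    using adm[of i] by (auto simp: riesz_admissible_def)
  have [measurable]: "f i \<in> borel_measurable ?M" and f_nonneg: "0 \<le> f i x" for i x
    using f_Lp[of i] by (auto simp: Lp_nonneg_def Lp_space_def)
  define F where "F x = (\<Sum>i. ennreal (f i x powr p))" for x
  have F_meas [measurable]: "F \<in> borel_measurable ?M"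
    unfolding F_def by measurable
  have F_int: "(\<integral>\<^sup>+x. F x \<partial>?M) = (\<Sum>i. ennreal (Lp_norm \<mu> p (f i) powr p))"
    unfolding F_def
    by (subst nn_integral_suminf) (simp_all add: Lp_norm_powr_eq_nn_integral[OF f_Lp p])
  have F_finite: "AE x in ?M. F x \<noteq> \<infinity>"
    using False by (intro nn_integral_PInf_AE) (simp_all add: F_int)
  \<comment> \<open>\<^const>\<open>enn2real\<close> sends \<open>\<infinity>\<close> to \<open>0\<close>, so \<open>g\<close> is finite everywhere.\<close>
  define g where "g x = enn2real (F x) powr (1 / p)" for x
  have g_meas [measurable]: "g \<in> borel_measurable ?M"
    unfolding g_def by measurable
  have g_powr: "g x powr p = enn2real (F x)" for x
    using p by (simp add: g_def powr_powr)
  have g_int: "(\<integral>\<^sup>+x. ennreal (g x powr p) \<partial>?M) = (\<integral>\<^sup>+x. F x \<partial>?M)"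
    by (rule nn_integral_cong_AE) (use F_finite in eventually_elim, simp add: g_powr less_top)
  have g_Lp: "g \<in> Lp_nonneg \<mu> p"
  proof -
    have "integrable ?M (\<lambda>x. g x powr p)"
      using False g_int F_int by (intro integrableI_nonneg) (auto simp: less_top)
    moreover have "0 \<le> g x" for x by (simp add: g_def)
    ultimately show ?thesis by (auto simp: Lp_nonneg_def Lp_space_def)
  qed
  have f_le_g: "AE x in ?M. f i x \<le> g x" for i
    using F_finite
  proof eventually_elim
    case (elim x)
    have "(\<Sum>j\<in>{i}. ennreal (f j x powr p)) \<le> F x"
      unfolding F_def by (rule sum_le_suminf) auto
    then have "ennreal (f i x powr p) \<le> F x" by simp
    then have "enn2real (ennreal (f i x powr p)) \<le> enn2real (F x)"
      using elim by (intro enn2real_mono) (simp_all add: less_top)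
    then have "(f i x powr p) powr (1 / p) \<le> enn2real (F x) powr (1 / p)"
      using p by (intro powr_mono2) auto
    then show ?case
      using p f_nonneg[of i x] by (simp add: g_def powr_powr)
  qed
  have "1 \<le> riesz_potential \<mu> \<gamma> g x" if x: "x \<in> E" for x
  proof -
    obtain i where "x \<in> A i" using cover x by blast
    then show ?thesis
      using f_ge_1 riesz_potential_mono_AE[OF f_le_g] order_trans by blast
  qed
  then have "g \<in> riesz_admissible \<mu> \<gamma> p E"
    using g_Lp by (auto simp: riesz_admissible_def)
  then have "riesz_capacity \<mu> \<gamma> p E \<le> ennreal (Lp_norm \<mu> p g powr p)"
    unfolding riesz_capacity_def by (rule INF_lower)
  also have "\<dots> = (\<Sum>i. ennreal (Lp_norm \<mu> p (f i) powr p))"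
    by (simp add: Lp_norm_powr_eq_nn_integral[OF g_Lp p] g_int F_int)
  finally show ?thesis .
qed

lemma zero_admissible_for_empty: "(\<lambda>_. 0) \<in> riesz_admissible \<mu> \<gamma> p {}"
  by (simp add: riesz_admissible_def Lp_nonneg_def Lp_space_def)

context doubling_metric_measure_space
begin

lemma borel_sets: "A \<in> sets borel \<Longrightarrow> A \<in> sets (caratheodory_measure \<mu>)"
  using borel_measurable_sets sets_caratheodory_measure[OF outer_measure] by auto

lemma emeasure_borel:
  "A \<in> sets borel \<Longrightarrow> emeasure (caratheodory_measure \<mu>) A = \<mu> A"
  using borel_measurable_sets emeasure_caratheodory_measure[OF outer_measure] by auto

lemma ball_mono:
  assumes "ball x r \<subseteq> ball y s"
  shows "\<mu> (ball x r) \<le> \<mu> (ball y s)"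
  using emeasure_mono[OF assms, of "caratheodory_measure \<mu>"]
  by (simp add: emeasure_borel borel_sets)

lemma ball_enn2real_pos: "0 < r \<Longrightarrow> 0 < enn2real (\<mu> (ball x r))"
  using ball_pos[of r x] ball_finite[of r x] by (simp add: enn2real_positive_iff)

lemma ennreal_enn2real_ball: "0 < r \<Longrightarrow> ennreal (enn2real (\<mu> (ball x r))) = \<mu> (ball x r)"
  using ball_finite[of r x] by simp

text \<open>Both points lie within \<open>r\<close> of \<open>x\<close>, so \<open>B(z,d(z,y)) \<subseteq> B(x,3r) \<subseteq> B(x,4r)\<close>, and doubling
  is used twice.\<close>

lemma ball_between_points_le:
  assumes c: "1 \<le> c" "\<And>x r. 0 < r \<Longrightarrow> \<mu> (ball x (2 * r)) \<le> ennreal c * \<mu> (ball x r)"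
    and r: "0 < r" and z: "z \<in> ball x r" and y: "y \<in> ball x r"
  shows "enn2real (\<mu> (ball z (dist z y))) \<le> c\<^sup>2 * enn2real (\<mu> (ball x r))"
proof -
  have "dist z y < 2 * r"
    using z y dist_triangle2[of z y x] by (simp add: dist_commute)
  then have "w \<in> ball x (2 * (2 * r))" if "w \<in> ball z (dist z y)" for w
    using that z r dist_triangle[of x w z] by simp
  then have "ball z (dist z y) \<subseteq> ball x (2 * (2 * r))" by blast
  then have "\<mu> (ball z (dist z y)) \<le> \<mu> (ball x (2 * (2 * r)))"
    by (rule ball_mono)
  also have "\<dots> \<le> ennreal c * \<mu> (ball x (2 * r))"
    using c(2)[of "2 * r" x] r by simp
  also have "\<dots> \<le> ennreal c * (ennreal c * \<mu> (ball x r))"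
    using c(2)[of r x] r by (intro mult_left_mono) auto
  also have "\<dots> = ennreal (c\<^sup>2 * enn2real (\<mu> (ball x r)))"
    using c(1) r
    by (subst ennreal_enn2real_ball[symmetric, OF r])
      (simp add: ennreal_mult power2_eq_square mult.assoc del: ennreal_enn2real)
  finally have "enn2real (\<mu> (ball z (dist z y))) \<le> enn2real (ennreal (c\<^sup>2 * enn2real (\<mu> (ball x r))))"
    by (intro enn2real_mono) auto
  then show ?thesis by simp
qed

text \<open>The height \<open>a\<close> is chosen so that \<open>a\<close> times the lower bound \<open>(c\<^sup>2m)\<^sup>\<gamma>\<^sup>-\<^sup>1\<close> for the kernel is
  \<open>1/m\<close>, where \<open>m\<close> is the measure of the ball.\<close>

lemma admissible_for_ball:
  assumes c: "1 \<le> c" "\<And>x r. 0 < r \<Longrightarrow> \<mu> (ball x (2 * r)) \<le> ennreal c * \<mu> (ball x r)"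
    and r: "0 < r" and p: "0 < p" and \<gamma>: "\<gamma> \<le> 1"
  obtains f where "f \<in> riesz_admissible \<mu> \<gamma> p (ball x r)"
    and "ennreal (Lp_norm \<mu> p f powr p)
           = ennreal ((c\<^sup>2) powr ((1 - \<gamma>) * p)) * ennreal (ball_powr \<mu> x r (1 - \<gamma> * p))"
proof
  let ?M = "caratheodory_measure \<mu>"
  define m where "m = enn2real (\<mu> (ball x r))"
  have m: "0 < m" and \<mu>_ball: "\<mu> (ball x r) = ennreal m"
    using ball_enn2real_pos[OF r] ennreal_enn2real_ball[OF r] by (simp_all add: m_def)
  define a where "a = (c\<^sup>2) powr (1 - \<gamma>) * m powr (- \<gamma>)"
  have a: "0 < a" using c(1) m by (simp add: a_def)
  define f where "f y = a * indicator (ball x r) y" for y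
  have B_meas [measurable]: "ball x r \<in> sets ?M"
    by (simp add: borel_sets)
  have f_powr: "f y powr p = a powr p * indicator (ball x r) y" for y
    using p by (simp add: f_def indicator_def)
  have f_nonneg: "0 \<le> f y" for y
    using a by (simp add: f_def)
  have f_meas: "f \<in> borel_measurable ?M"
    unfolding f_def by measurable
  have "integrable ?M (\<lambda>y. f y powr p)"
    unfolding f_powr
    by (intro integrable_mult_right integrable_real_indicator) (simp_all add: emeasure_borel \<mu>_ball)
  then have f_Lp: "f \<in> Lp_nonneg \<mu> p"
    using f_nonneg f_meas by (simp add: Lp_nonneg_def Lp_space_def)
  have "1 \<le> riesz_potential \<mu> \<gamma> f z" if z: "z \<in> ball x r" for z
  proof -
    have "emeasure ?M (ball x r - {z}) = emeasure ?M (ball x r)"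
      by (intro emeasure_Diff_null_set null_setsI) (simp_all add: emeasure_borel point_null borel_sets)
    then have "1 = ennreal (1 / m) * emeasure ?M (ball x r - {z})"
      using m by (simp add: emeasure_borel \<mu>_ball flip: ennreal_mult)
    also have "\<dots> = (\<integral>\<^sup>+y. ennreal (1 / m) * indicator (ball x r - {z}) y \<partial>?M)"
      by (subst nn_integral_cmult_indicator) (simp_all add: borel_sets)
    also have "\<dots> \<le> riesz_potential \<mu> \<gamma> f z"
      unfolding riesz_potential_def
    proof (intro nn_integral_mono)
      fix y
      have "1 / m \<le> a / ball_powr \<mu> z (dist z y) (1 - \<gamma>)" if y: "y \<in> ball x r" "y \<noteq> z"
      proof -
        have pos: "0 < ball_powr \<mu> z (dist z y) (1 - \<gamma>)"
          using ball_enn2real_pos[of "dist z y" z] y by (simp add: ball_powr_def)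
        have "ball_powr \<mu> z (dist z y) (1 - \<gamma>) \<le> (c\<^sup>2 * m) powr (1 - \<gamma>)"
          unfolding ball_powr_def m_def using \<gamma>
          by (intro powr_mono2 ball_between_points_le[OF c r z y(1)]) auto
        also have "\<dots> = a * m"
          using m c(1) powr_add[of m "- \<gamma>" 1] by (simp add: a_def powr_mult)
        finally show ?thesis
          using pos m by (simp add: field_simps)
      qed
      then show "ennreal (1 / m) * indicator (ball x r - {z}) y
          \<le> ennreal (f y / ball_powr \<mu> z (dist z y) (1 - \<gamma>)) * indicator (- {z}) y"
        by (auto simp: f_def indicator_def intro: ennreal_leI)
    qed
    finally show ?thesis .
  qed
  then show "f \<in> riesz_admissible \<mu> \<gamma> p (ball x r)"
    using f_Lp by (simp add: riesz_admissible_def)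
  have "ennreal (Lp_norm \<mu> p f powr p) = (\<integral>\<^sup>+y. ennreal (a powr p) * indicator (ball x r) y \<partial>?M)"
    unfolding Lp_norm_powr_eq_nn_integral[OF f_Lp p] f_powr
    by (intro nn_integral_cong) (simp add: indicator_def)
  also have "\<dots> = ennreal (a powr p * m)"
    by (subst nn_integral_cmult_indicator) (simp_all add: emeasure_borel \<mu>_ball ennreal_mult')
  also have "a powr p * m = (c\<^sup>2) powr ((1 - \<gamma>) * p) * m powr (1 - \<gamma> * p)"
    using m c(1) powr_add[of m "- (\<gamma> * p)" 1] by (simp add: a_def powr_mult powr_powr)
  finally show "ennreal (Lp_norm \<mu> p f powr p)
      = ennreal ((c\<^sup>2) powr ((1 - \<gamma>) * p)) * ennreal (ball_powr \<mu> x r (1 - \<gamma> * p))"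
    by (simp add: ball_powr_def m_def ennreal_mult)
qed

end

theorem theorem4p2:
  fixes \<mu> :: "'a::metric_space set \<Rightarrow> ennreal" and \<gamma> p :: real
  assumes "doubling_metric_measure_space \<mu>"
    and "1 < p" and "0 < \<gamma>" and "\<gamma> < 1" and "\<gamma> * p < 1"
  shows "\<exists>C::real. C > 0 \<and>
    (\<forall>x r. r > 0 \<longrightarrow>
      riesz_capacity \<mu> \<gamma> p (ball x r) \<le> ennreal C * ennreal (ball_powr \<mu> x r (1 - \<gamma> * p))) \<and>
    (\<forall>E. riesz_capacity \<mu> \<gamma> p E \<le> ennreal C * modified_hausdorff_content \<mu> \<gamma> p \<infinity> E)"
proof -
  interpret doubling_metric_measure_space \<mu> by fact
  have p: "0 < p" using \<open>1 < p\<close> by simp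
  obtain c :: real where c: "1 \<le> c" "\<And>x r. 0 < r \<Longrightarrow> \<mu> (ball x (2 * r)) \<le> ennreal c * \<mu> (ball x r)"
    using doubling by auto
  define C where "C = (c\<^sup>2) powr ((1 - \<gamma>) * p)"
  have C: "0 < C" using c(1) by (simp add: C_def)
  have test: "\<exists>f. f \<in> riesz_admissible \<mu> \<gamma> p (ball x r) \<and>
      ennreal (Lp_norm \<mu> p f powr p) = ennreal C * ennreal (ball_powr \<mu> x r (1 - \<gamma> * p))"
    if "0 < r" for x r
    using admissible_for_ball[OF c that p, of \<gamma> x] \<open>\<gamma> < 1\<close> unfolding C_def
    by (metis less_imp_le)
  have "riesz_capacity \<mu> \<gamma> p (ball x r) \<le> ennreal C * ennreal (ball_powr \<mu> x r (1 - \<gamma> * p))"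
    if "0 < r" for x r
    using test[OF that, of x] unfolding riesz_capacity_def by (metis INF_lower)
  moreover have "riesz_capacity \<mu> \<gamma> p E \<le> ennreal C * modified_hausdorff_content \<mu> \<gamma> p \<infinity> E" for E
  proof -
    have cover_bound: "riesz_capacity \<mu> \<gamma> p E
        \<le> ennreal C * (\<Sum>i. if i \<in> I then ennreal (ball_powr \<mu> (x i) (r i) (1 - \<gamma> * p)) else 0)"
      if E: "E \<subseteq> (\<Union>i\<in>I. ball (x i) (r i))" and r: "\<And>i. i \<in> I \<Longrightarrow> 0 < r i"
      for I :: "nat set" and x :: "nat \<Rightarrow> 'a" and r :: "nat \<Rightarrow> real"
    proof -
      have "\<forall>i\<in>I. \<exists>f. f \<in> riesz_admissible \<mu> \<gamma> p (ball (x i) (r i)) \<and>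
          ennreal (Lp_norm \<mu> p f powr p)
            = ennreal C * ennreal (ball_powr \<mu> (x i) (r i) (1 - \<gamma> * p))"
        using test[OF r] by blast
      from bchoice[OF this]
      obtain f where f: "\<forall>i\<in>I. f i \<in> riesz_admissible \<mu> \<gamma> p (ball (x i) (r i)) \<and>
          ennreal (Lp_norm \<mu> p (f i) powr p)
            = ennreal C * ennreal (ball_powr \<mu> (x i) (r i) (1 - \<gamma> * p))"
        by blast
      let ?A = "\<lambda>i. if i \<in> I then ball (x i) (r i) else {}"
      let ?f = "\<lambda>i. if i \<in> I then f i else (\<lambda>_. 0)"
      have "riesz_capacity \<mu> \<gamma> p E \<le> (\<Sum>i. ennreal (Lp_norm \<mu> p (?f i) powr p))"
        by (rule riesz_capacity_le_suminf[OF p, where A = ?A])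
          (use f E zero_admissible_for_empty in auto)
      also have "\<dots> = (\<Sum>i. ennreal C *
          (if i \<in> I then ennreal (ball_powr \<mu> (x i) (r i) (1 - \<gamma> * p)) else 0))"
        using f p by (intro suminf_cong) (simp add: Lp_norm_def)
      finally show ?thesis by simp
    qed
    have "riesz_capacity \<mu> \<gamma> p E / ennreal C \<le> modified_hausdorff_content \<mu> \<gamma> p \<infinity> E"
      unfolding modified_hausdorff_content_def
    proof (rule Inf_greatest, clarify)
      fix I :: "nat set" and x :: "nat \<Rightarrow> 'a" and r :: "nat \<Rightarrow> real"
      assume "E \<subseteq> (\<Union>i\<in>I. ball (x i) (r i))"
        and "\<forall>i\<in>I. x i \<in> E \<and> 0 < r i \<and> ereal (r i) \<le> \<infinity>"
      then show "riesz_capacity \<mu> \<gamma> p E / ennreal C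
          \<le> (\<Sum>i. if i \<in> I then ennreal (ball_powr \<mu> (x i) (r i) (1 - \<gamma> * p)) else 0)"
        using cover_bound[where I = I and x = x and r = r] C by (intro divide_le_posI_ennreal) auto
    qed
    then have "ennreal C * (riesz_capacity \<mu> \<gamma> p E / ennreal C)
        \<le> ennreal C * modified_hausdorff_content \<mu> \<gamma> p \<infinity> E"
      by (rule mult_left_mono) simp
    then show ?thesis
      using C by (simp add: ennreal_times_divide mult.commute[of "ennreal C"] ennreal_mult_divide_eq)
  qed
  ultimately show ?thesis using C by blast
qed

end
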